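(* Let $n\ge 1$ be an integer, let $f(\lambda)$ be analytic at $\lambda_0\in\mathbb{C}$ with $f(\lambda_0)\neq 0$, and let $g(\lambda)$ be analytic at $\lambda_0$ with $\lambda_0$ a zero of $g$ of order $n$. Then $$\lim^{\times}_{\lambda\to\lambda_0}\frac{f(\lambda)}{g(\lambda)}=\frac{f^{(n)}(\lambda_0)}{g^{(n)}(\lambda_0)}+\frac{1}{g^{(n)}(\lambda_0)}\sum_{k=1}^{n}k!\binom{n}{k}f^{(n-k)}(\lambda_0)\sum_{i=1}^{p(k)}J_i^{(k)}!\prod_{r=1}^{k}\frac{1}{m_{ri}!}\left[-\frac{n!}{(r+n)!}\frac{g^{(r+n)}(\lambda_0)}{g^{(n)}(\lambda_0)}\right]^{m_{ri}}.$$
   Context: Regularized limit: if $w$ is analytic in a punctured neighbourhood of $\lambda_0$ with Laurent expansion $w(\lambda)=\sum_{k=-\infty}^{\infty}a_k(\lambda-\lambda_0)^k$, and $w_P(\lambda\mid\lambda_0)=\sum_{k\ge1}a_{-k}(\lambda-\lambda_0)^{-k}$ is its principal part, then $\lim^{\times}_{\lambda\to\lambda_0}w(\lambda):=\lim_{\lambda\to\lambda_0}[w(\lambda)-w_P(\lambda\mid\lambda_0)]=a_0$. Partition notation: for $k\in\mathbb{N}$, $p(k)$ is the number of partitions of $k$. The partitions of $k$ are enumerated by $i=1,\dots,p(k)$; the $i$-th partition is encoded by non-negative integers $m_{1i},\dots,m_{ki}$ with $k=m_{1i}+2m_{2i}+\cdots+k\,m_{ki}$ ($m_{ri}$ is the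 number of parts equal to $r$), and $J_i^{(k)}=\sum_{\ell=1}^{k}m_{\ell i}$ is the number of parts. The convention $x^0=1$ is used. *)

theory Defs
  imports "HOL-Complex_Analysis.Complex_Analysis"
begin

text \<open>
  A two-sided Laurent expansion, so that essential singularities are covered; the library's
  \<open>has_laurent_expansion\<close> only allows finitely many negative powers.  Unconditional convergence
  is no restriction, since Laurent series converge absolutely on their open annulus.
\<close>

definition has_laurent_coeffs :: "(complex \<Rightarrow> complex) \<Rightarrow> complex \<Rightarrow> (int \<Rightarrow> complex) \<Rightarrow> bool" where
  "has_laurent_coeffs w z0 a \<longleftrightarrow>
     isolated_singularity_at w z0 \<and>
     (\<forall>\<^sub>F z in at z0. ((\<lambda>k. a k * (z - z0) powi k) has_sum w z) UNIV)"

definition principal_part :: "(int \<Rightarrow> complex) \<Rightarrow> complex \<Rightarrow> complex \<Rightarrow> complex" where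
  "principal_part a z0 z = (\<Sum>\<^sub>\<infinity>k\<in>{1::nat..}. a (- int k) * (z - z0) powi (- int k))"

text \<open>
  The regularized limit exists and equals \<open>L\<close>.  The coefficients \<open>a\<close> are determined by \<open>w\<close>,
  so the existential quantifier leaves no choice.
\<close>

definition has_reg_limit :: "(complex \<Rightarrow> complex) \<Rightarrow> complex \<Rightarrow> complex \<Rightarrow> bool" where
  "has_reg_limit w z0 L \<longleftrightarrow>
     (\<exists>a. has_laurent_coeffs w z0 a \<and> (\<lambda>z. w z - principal_part a z0 z) \<midarrow>z0\<rightarrow> L)"

text \<open>
  A partition of \<open>k\<close> is encoded by its multiplicities: \<open>m r\<close> is the number of parts equal to
  \<open>r\<close>.  Values outside \<open>{1..k}\<close> are set to 0 so that each partition has exactly one code.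
\<close>

definition partitions :: "nat \<Rightarrow> (nat \<Rightarrow> nat) set" where
  "partitions k = {m. (\<forall>r. r \<notin> {1..k} \<longrightarrow> m r = 0) \<and> (\<Sum>r=1..k. r * m r) = k}"

definition num_parts :: "nat \<Rightarrow> (nat \<Rightarrow> nat) \<Rightarrow> nat" where
  "num_parts k m = (\<Sum>l=1..k. m l)"

lemma finite_partitions: "finite (partitions k)"
proof (rule finite_subset)
  show "partitions k \<subseteq> {m. \<forall>r. (r \<in> {1..k} \<longrightarrow> m r \<in> {..k}) \<and> (r \<notin> {1..k} \<longrightarrow> m r = 0)}"
  proof (intro subsetI CollectI allI conjI impI)
    fix m r assume m: "m \<in> partitions k" and r: "r \<in> {1..k}"
    have "m r \<le> r * m r" using r by simp
    also have "\<dots> \<le> (\<Sum>r=1..k. r * m r)" using r by (intro member_le_sum) auto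
    also have "\<dots> = k" using m by (simp add: partitions_def)
    finally show "m r \<in> {..k}" by simp
  qed (auto simp: partitions_def)
  show "finite {m. \<forall>r. (r \<in> {1..k} \<longrightarrow> m r \<in> {..k}) \<and> (r \<notin> {1..k} \<longrightarrow> m r = (0::nat))}"
    by (intro finite_set_of_finite_funs) auto
qed

end

theory Submission
  imports Defs
begin

text \<open>
  Writing \<open>x = z - z0\<close>, \<open>g = g\<^sub>n x\<^sup>n (1 - U(x))\<close> with \<open>U(x) = (\<Sum>r\<ge>1. c\<^sub>r x\<^sup>r)\<close> and
  \<open>c\<^sub>r = - g\<^bsub>n+r\<^esub> / g\<^sub>n\<close>, the quotient \<open>f / g\<close> is \<open>x\<^bsup>-n\<^esup>\<close> times the power series
  \<open>f / (g\<^sub>n (1 - U))\<close>, and the regularized limit is the coefficient of \<open>x\<^sup>n\<close> in the latter.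
  The sums over partitions are the coefficients of \<open>1 / (1 - U)\<close>: decreasing one multiplicity
  \<open>m r > 0\<close> by one, and splitting \<open>J! = (\<Sum>r. m r) (J - 1)!\<close>, shows that they satisfy
  \<open>S\<^sub>k = (\<Sum>r=1..k. c\<^sub>r S\<^bsub>k-r\<^esub>)\<close>.
\<close>

section \<open>Weighted sums over partitions\<close>

text \<open>The factorial of the number of parts, divided by the factorials of the
  \<open>m r\<close>, counts the orderings of the parts. So \<open>partition_sum c k\<close> amounts
  to a sum over the compositions of k, each weighted by the product of the \<open>c r\<close> over
  its parts.\<close>

definition partition_weight :: "nat \<Rightarrow> (nat \<Rightarrow> 'a::field_char_0) \<Rightarrow> (nat \<Rightarrow> nat) \<Rightarrow> 'a" where
  "partition_weight k c m = fact (num_parts k m) * (\<Prod>r=1..k. 1 / fact (m r) * c r ^ m r)"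

definition partition_sum :: "(nat \<Rightarrow> 'a::field_char_0) \<Rightarrow> nat \<Rightarrow> 'a" where
  "partition_sum c k = (\<Sum>m\<in>partitions k. partition_weight k c m)"

lemma partition_sum_0 [simp]: "partition_sum c 0 = 1"
proof -
  have "partitions 0 = {\<lambda>_. 0}"
    by (auto simp: partitions_def)
  then show ?thesis
    by (simp add: partition_sum_def partition_weight_def num_parts_def)
qed

text \<open>Lets weights for k - r be compared with weights for k in the recurrence: the additional
  multiplicities are 0, so they add no parts and only factors 1.\<close>

lemma partition_weight_mono_neutral:
  assumes "m \<in> partitions j" "j \<le> k"
  shows "partition_weight k c m = partition_weight j c m"
proof -
  have 0: "m r = 0" if "r \<notin> {1..j}" for r
    using assms(1) that unfolding partitions_def by blast
  have "num_parts k m = num_parts j m"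
    unfolding num_parts_def by (rule sum.mono_neutral_right) (use assms(2) 0 in auto)
  moreover have "(\<Prod>r=1..k. 1 / fact (m r) * c r ^ m r) = (\<Prod>r=1..j. 1 / fact (m r) * c r ^ m r)"
    by (rule prod.mono_neutral_right) (use assms(2) 0 in auto)
  ultimately show ?thesis
    by (simp add: partition_weight_def)
qed

section \<open>Removing or adding a part, and the resulting recurrence\<close>

lemma partitions_remove_part:
  assumes "m \<in> partitions k" "r \<in> {1..k}" "m r > 0"
  shows "m(r := m r - 1) \<in> partitions (k - r)"
proof -
  have 0: "m s = 0" if "s \<notin> {1..k}" for s
    using assms(1) that unfolding partitions_def by blast
  have "(\<Sum>s=1..k. s * m s) = r * m r + (\<Sum>s\<in>{1..k} - {r}. s * m s)"
    using assms(2) by (subst sum.remove[of _ r]) auto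
  moreover have "(\<Sum>s=1..k. s * (m(r := m r - 1)) s) = r * (m r - 1) + (\<Sum>s\<in>{1..k} - {r}. s * m s)"
    using assms(2) by (subst sum.remove[of _ r]) auto
  moreover have "r * m r = r * (m r - 1) + r"
    using assms(3) by (cases "m r") auto
  moreover have "(\<Sum>s=1..k. s * m s) = k"
    using assms(1) by (simp add: partitions_def)
  ultimately have sum: "(\<Sum>s=1..k. s * (m(r := m r - 1)) s) = k - r"
    by linarith
  \<comment> \<open>The code of a partition of k - r must vanish above k - r: a single part s > k -
    r would already exceed the total.\<close>
  have large: "(m(r := m r - 1)) s = 0" if "s \<in> {1..k}" "s > k - r" for s
  proof (rule ccontr)
    assume nz: "(m(r := m r - 1)) s \<noteq> 0"
    have "s \<le> s * (m(r := m r - 1)) s"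
      using nz by simp
    also have "\<dots> \<le> (\<Sum>s=1..k. s * (m(r := m r - 1)) s)"
      using that by (intro member_le_sum) auto
    finally show False
      using sum that by linarith
  qed
  have outside: "(m(r := m r - 1)) s = 0" if "s \<notin> {1..k - r}" for s
  proof (cases "s \<in> {1..k}")
    case True
    then show ?thesis using that by (intro large) auto
  next
    case False
    then show ?thesis using 0[of s] assms(2) by auto
  qed
  have "(\<Sum>s=1..k - r. s * (m(r := m r - 1)) s) = (\<Sum>s=1..k. s * (m(r := m r - 1)) s)"
    by (intro sum.mono_neutral_left ballI) (use outside in auto)
  with sum outside show ?thesis
    unfolding partitions_def by simp
qed

lemma partitions_insert_part:
  assumes "m \<in> partitions (k - r)" "r \<in> {1..k}"
  shows "m(r := Suc (m r)) \<in> partitions k"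
proof -
  have 0: "m s = 0" if "s \<notin> {1..k - r}" for s
    using assms(1) that unfolding partitions_def by blast
  have "(\<Sum>s=1..k. s * m s) = (\<Sum>s=1..k - r. s * m s)"
    by (rule sum.mono_neutral_right) (use 0 in auto)
  also have "\<dots> = k - r"
    using assms(1) by (simp add: partitions_def)
  finally have sum: "(\<Sum>s=1..k. s * m s) = k - r" .
  have "(\<Sum>s=1..k. s * m s) = r * m r + (\<Sum>s\<in>{1..k} - {r}. s * m s)"
    using assms(2) by (subst sum.remove[of _ r]) auto
  moreover have "(\<Sum>s=1..k. s * (m(r := Suc (m r))) s) = r * Suc (m r) + (\<Sum>s\<in>{1..k} - {r}. s * m s)"
    using assms(2) by (subst sum.remove[of _ r]) auto
  ultimately have "(\<Sum>s=1..k. s * (m(r := Suc (m r))) s) = k"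
    using sum assms(2) unfolding mult_Suc_right atLeastAtMost_iff by linarith
  moreover have "(m(r := Suc (m r))) s = 0" if "s \<notin> {1..k}" for s
    using 0[of s] that assms(2) by auto
  ultimately show ?thesis
    unfolding partitions_def by blast
qed

text \<open>With J parts in m, J! becomes (J + 1)!, the denominator (m r)! becomes (m r + 1)!, and
  one factor \<open>c r\<close> is gained; all factors for s \<noteq> r stay the same.\<close>

lemma partition_weight_insert_part:
  assumes "r \<in> {1..k}"
  shows "of_nat (Suc (m r)) * partition_weight k c (m(r := Suc (m r))) =
         of_nat (Suc (num_parts k m)) * (c r * partition_weight k c m)"
proof -
  have "num_parts k (m(r := Suc (m r))) = Suc (m r) + (\<Sum>s\<in>{1..k} - {r}. m s)"
    using assms unfolding num_parts_def by (subst sum.remove[of _ r]) auto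
  moreover have "num_parts k m = m r + (\<Sum>s\<in>{1..k} - {r}. m s)"
    using assms unfolding num_parts_def by (subst sum.remove[of _ r]) auto
  ultimately have J: "num_parts k (m(r := Suc (m r))) = Suc (num_parts k m)"
    by simp
  define P where "P = (\<Prod>s\<in>{1..k} - {r}. 1 / fact (m s) * c s ^ m s)"
  have 1: "(\<Prod>s=1..k. 1 / fact (m s) * c s ^ m s) = 1 / fact (m r) * c r ^ m r * P"
    using assms unfolding P_def by (subst prod.remove[of _ r]) auto
  have "(\<Prod>s=1..k. 1 / fact ((m(r := Suc (m r))) s) * c s ^ (m(r := Suc (m r))) s) =
      1 / fact (Suc (m r)) * c r ^ Suc (m r) * (\<Prod>s\<in>{1..k} - {r}.
        1 / fact ((m(r := Suc (m r))) s) * c s ^ (m(r := Suc (m r))) s)"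
    using assms by (subst prod.remove[of _ r]) auto
  also have "(\<Prod>s\<in>{1..k} - {r}. 1 / fact ((m(r := Suc (m r))) s) * c s ^ (m(r := Suc (m r))) s) = P"
    unfolding P_def by (rule prod.cong) auto
  finally have 2: "(\<Prod>s=1..k. 1 / fact ((m(r := Suc (m r))) s) * c s ^ (m(r := Suc (m r))) s) =
      1 / fact (Suc (m r)) * c r ^ Suc (m r) * P" .
  have nz: "(of_nat (Suc (m r)) :: 'a) \<noteq> 0"
    by (simp only: of_nat_eq_0_iff)
  show ?thesis
    unfolding partition_weight_def 1 2 J fact_Suc using nz
    by (simp add: divide_simps del: of_nat_Suc)
qed

text \<open>In terms of compositions, r is the first part: among the orderings of the parts of m,
  the fraction \<open>m r / num_parts k m\<close> starts with r, and deleting this part leaves a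
  composition of k - r.\<close>

lemma partition_sum_rec:
  assumes "k > 0"
  shows "partition_sum c k = (\<Sum>r=1..k. c r * partition_sum c (k - r))"
proof -
  have parts_pos: "num_parts k m > 0" if "m \<in> partitions k" for m
  proof (rule ccontr)
    assume "\<not> num_parts k m > 0"
    then have "\<And>s. s \<in> {1..k} \<Longrightarrow> m s = 0"
      by (auto simp: num_parts_def)
    then have "(\<Sum>s=1..k. s * m s) = 0"
      by simp
    with that assms show False
      by (auto simp: partitions_def)
  qed
  \<comment> \<open>For each m these fractions add up to 1; the denominator is nonzero because k >
    0.\<close>
  have "partition_sum c k = (\<Sum>m\<in>partitions k. \<Sum>r=1..k.
      of_nat (m r) / of_nat (num_parts k m) * partition_weight k c m)"
    unfolding partition_sum_def
  proof (intro sum.cong refl)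
    fix m assume m: "m \<in> partitions k"
    have "(\<Sum>r=1..k. of_nat (m r) :: 'a) = of_nat (num_parts k m)"
      by (simp add: num_parts_def)
    then show "partition_weight k c m =
        (\<Sum>r=1..k. of_nat (m r) / of_nat (num_parts k m) * partition_weight k c m)"
      using parts_pos[OF m]
      by (simp flip: sum_distrib_right sum_divide_distrib)
  qed
  also have "\<dots> = (\<Sum>r=1..k. \<Sum>m\<in>partitions k.
      of_nat (m r) / of_nat (num_parts k m) * partition_weight k c m)"
    by (rule sum.swap)
  also have "\<dots> = (\<Sum>r=1..k. c r * partition_sum c (k - r))"
  proof (intro sum.cong refl)
    fix r assume r: "r \<in> {1..k}"
    \<comment> \<open>Terms with \<open>m r = 0\<close> vanish. Without them \<open>m r - 1\<close>
      is a true subtraction, so removing r is inverse to adding it.\<close>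
    have "(\<Sum>m\<in>partitions k. of_nat (m r) / of_nat (num_parts k m) * partition_weight k c m) =
        (\<Sum>m | m \<in> partitions k \<and> m r > 0.
          of_nat (m r) / of_nat (num_parts k m) * partition_weight k c m)"
      by (rule sum.mono_neutral_right) (auto simp: finite_partitions)
    also have "\<dots> = (\<Sum>m\<in>partitions (k - r). c r * partition_weight (k - r) c m)"
    proof (rule sum.reindex_bij_witness[of _ "\<lambda>m. m(r := Suc (m r))" "\<lambda>m. m(r := m r - 1)"])
      fix m assume "m \<in> {m \<in> partitions k. m r > 0}"
      then have m: "m \<in> partitions k" "m r > 0"
        by auto
      define m' where "m' = m(r := m r - 1)"
      have m_eq: "m = m'(r := Suc (m' r))"
        using m(2) by (auto simp: m'_def)
      have m'k: "m' \<in> partitions (k - r)"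
        unfolding m'_def using m r by (intro partitions_remove_part)
      show "m(r := m r - 1, r := Suc ((m(r := m r - 1)) r)) = m"
        using m(2) by auto
      show "m(r := m r - 1) \<in> partitions (k - r)"
        using m'k by (simp add: m'_def)
      have "num_parts k m = Suc (num_parts k m')"
        using m(2) r unfolding num_parts_def m'_def
        by (subst (1 2) sum.remove[of _ r]) auto
      then have "of_nat (m r) * partition_weight k c m =
          of_nat (num_parts k m) * (c r * partition_weight k c m')"
        using partition_weight_insert_part[OF r, of m' c] m_eq
        by (metis fun_upd_same)
      moreover have "partition_weight k c m' = partition_weight (k - r) c m'"
        by (rule partition_weight_mono_neutral[OF m'k]) simp
      ultimately show "c r * partition_weight (k - r) c (m(r := m r - 1)) =
          of_nat (m r) / of_nat (num_parts k m) * partition_weight k c m"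
        using parts_pos[OF m(1)] unfolding m'_def by simp
    next
      fix m assume m: "m \<in> partitions (k - r)"
      show "m(r := Suc (m r), r := (m(r := Suc (m r))) r - 1) = m"
        by auto
      show "m(r := Suc (m r)) \<in> {m \<in> partitions k. m r > 0}"
        using partitions_insert_part[OF m r] by simp
    qed
    also have "\<dots> = c r * partition_sum c (k - r)"
      by (simp add: partition_sum_def sum_distrib_left)
    finally show "(\<Sum>m\<in>partitions k. of_nat (m r) / of_nat (num_parts k m) * partition_weight k c m) =
        c r * partition_sum c (k - r)" .
  qed
  finally show ?thesis .
qed

section \<open>The reciprocal of a power series\<close>

lemma fps_inverse_eq_partition_sum:
  fixes H :: "'a::field_char_0 fps"
  assumes "fps_nth H 0 \<noteq> 0"
  shows "fps_nth (inverse H) k =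
           partition_sum (\<lambda>r. - (fps_nth H r / fps_nth H 0)) k / fps_nth H 0"
proof -
  define c where "c = (\<lambda>r. - (fps_nth H r / fps_nth H 0))"
  define S where "S = Abs_fps (\<lambda>k. partition_sum c k / fps_nth H 0)"
  have "H * S = 1"
  proof (rule fps_ext)
    fix k
    show "fps_nth (H * S) k = fps_nth 1 k"
    proof (cases "k = 0")
      case True
      then show ?thesis using assms by (simp add: S_def)
    next
      case False
      have "fps_nth (H * S) k = (\<Sum>r=0..k. fps_nth H r * (partition_sum c (k - r) / fps_nth H 0))"
        by (simp add: fps_mult_nth S_def)
      \<comment> \<open>The term r = 0 loses its factor \<open>fps_nth H 0\<close>; the remaining
        terms are the negated right-hand side of the recurrence, so the coefficient is 0.\<close>
      also have "\<dots> = partition_sum c k + (\<Sum>r=1..k. fps_nth H r * (partition_sum c (k - r) / fps_nth H 0))"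
        using assms by (subst sum.atLeast_Suc_atMost) auto
      also have "(\<Sum>r=1..k. fps_nth H r * (partition_sum c (k - r) / fps_nth H 0)) =
          - (\<Sum>r=1..k. c r * partition_sum c (k - r))"
        by (simp add: c_def sum_negf)
      finally show ?thesis
        using False partition_sum_rec[of k c] by simp
    qed
  qed
  then have "inverse H = S"
    using fps_inverse_unique by blast
  then show ?thesis
    by (simp add: S_def c_def)
qed

section \<open>The regularized limit at a pole\<close>

text \<open>The first n terms of Q, divided by the n-th power of z - z0, form the principal part.
  What remains is the series \<open>fps_shift n Q\<close>, which is continuous at 0 with value
  \<open>fps_nth Q n\<close>.\<close>

lemma has_reg_limit_pole:
  assumes iso: "isolated_singularity_at w z0"
    and Q: "fps_conv_radius Q > 0"
    and w: "\<forall>\<^sub>F z in at z0. w z = eval_fps Q (z - z0) / (z - z0) ^ n"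
  shows "has_reg_limit w z0 (fps_nth Q n)"
  unfolding has_reg_limit_def
proof (intro exI conjI)
  \<comment> \<open>The case distinction is essential: \<open>nat\<close> sends negative integers to
    0, which would put \<open>fps_nth Q 0\<close> at every k < -n.\<close>
  define a where "a = (\<lambda>k::int. if k < - int n then 0 else fps_nth Q (nat (k + int n)))"
  have "\<forall>\<^sub>F z in at z0. z - z0 \<in> eball 0 (fps_conv_radius Q) \<and> z \<noteq> z0"
  proof -
    have "\<forall>\<^sub>F x in at (0 :: complex). x \<in> eball 0 (fps_conv_radius Q) - {0}"
      using Q by (intro eventually_at_in_open) (auto simp: zero_ereal_def)
    then show ?thesis
      by (subst eventually_at_to_0) simp
  qed
  with w have ev: "\<forall>\<^sub>F z in at z0. w z = eval_fps Q (z - z0) / (z - z0) ^ n \<and>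
      ereal (norm (z - z0)) < fps_conv_radius Q \<and> z \<noteq> z0"
    by eventually_elim auto
  show "has_laurent_coeffs w z0 a"
    unfolding has_laurent_coeffs_def
  proof (intro conjI iso)
    show "\<forall>\<^sub>F z in at z0. ((\<lambda>k. a k * (z - z0) powi k) has_sum w z) UNIV"
      using ev
    proof eventually_elim
      case (elim z)
      define x where "x = z - z0"
      have x: "x \<noteq> 0" "ereal (norm x) < fps_conv_radius Q"
        using elim by (auto simp: x_def)
      \<comment> \<open>Absolute convergence inside the disc turns the ordered series into an
        unordered sum, which can be reindexed by integers.\<close>
      have "((\<lambda>j. fps_nth Q j * x ^ j) has_sum eval_fps Q x) UNIV"
        using x by (intro norm_summable_imp_has_sum norm_summable_fps sums_eval_fps)
      then have "((\<lambda>j. 1 / x ^ n * (fps_nth Q j * x ^ j)) has_sum (1 / x ^ n * eval_fps Q x)) UNIV"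
        by (rule has_sum_cmult_right)
      also have "1 / x ^ n * eval_fps Q x = w z"
        using elim by (simp add: x_def)
      also have "((\<lambda>j. 1 / x ^ n * (fps_nth Q j * x ^ j)) has_sum w z) UNIV \<longleftrightarrow>
          ((\<lambda>k. a k * x powi k) has_sum w z) {- int n..}"
        by (rule has_sum_reindex_bij_witness
              [of _ "\<lambda>k. nat (k + int n)" "\<lambda>j. int j - int n"])
           (use x in \<open>auto simp: a_def power_int_diff\<close>)
      also have "\<dots> \<longleftrightarrow> ((\<lambda>k. a k * x powi k) has_sum w z) UNIV"
        by (rule has_sum_cong_neutral) (auto simp: a_def)
      finally show ?case
        by (simp add: x_def)
    qed
  qed
  have "isCont (eval_fps (fps_shift n Q)) 0"
    using Q by (intro continuous_on_interior[OF continuous_on_eval_fps])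
      (auto simp: interior_open zero_ereal_def)
  then have "eval_fps (fps_shift n Q) \<midarrow>0\<rightarrow> fps_nth Q n"
    by (simp add: isCont_def eval_fps_at_0)
  then have "(\<lambda>z. eval_fps (fps_shift n Q) (z - z0)) \<midarrow>z0\<rightarrow> fps_nth Q n"
    by (subst LIM_offset_zero_iff[of z0]) simp_all
  moreover have "\<forall>\<^sub>F z in at z0. eval_fps (fps_shift n Q) (z - z0) = w z - principal_part a z0 z"
    using ev
  proof eventually_elim
    case (elim z)
    define x where "x = z - z0"
    have x: "x \<noteq> 0" "ereal (norm x) < fps_conv_radius Q"
      using elim by (auto simp: x_def)
    have "principal_part a z0 z = (\<Sum>\<^sub>\<infinity>k\<in>{1..n}. a (- int k) * x powi (- int k))"
      unfolding principal_part_def x_def by (rule infsum_cong_neutral) (auto simp: a_def)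
    also have "\<dots> = (\<Sum>k=1..n. a (- int k) * x powi (- int k))"
      by simp
    \<comment> \<open>Substitute j = n - k.\<close>
    also have "\<dots> = (\<Sum>j<n. fps_nth Q j * x ^ j / x ^ n)"
      by (rule sum.reindex_bij_witness[of _ "\<lambda>j. n - j" "\<lambda>k. n - k"])
         (use x in \<open>auto simp: a_def power_diff power_int_minus field_simps nat_diff_distrib' of_nat_diff\<close>)
    also have "\<dots> = (\<Sum>j<n. fps_nth Q j * x ^ j) / x ^ n"
      by (simp add: sum_divide_distrib)
    finally have pp: "principal_part a z0 z = (\<Sum>j<n. fps_nth Q j * x ^ j) / x ^ n" .
    have "(\<lambda>j. fps_nth Q j * x ^ j) sums eval_fps Q x"
      using x by (intro sums_eval_fps)
    then have "(\<lambda>j. fps_nth Q (j + n) * x ^ (j + n)) sums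
        (eval_fps Q x - (\<Sum>j<n. fps_nth Q j * x ^ j))"
      by (rule sums_split_initial_segment)
    moreover have "(\<lambda>j. fps_nth (fps_shift n Q) j * x ^ j * x ^ n) sums
        (eval_fps (fps_shift n Q) x * x ^ n)"
      using x by (intro sums_mult2 sums_eval_fps) simp
    ultimately have "eval_fps (fps_shift n Q) x * x ^ n =
        eval_fps Q x - (\<Sum>j<n. fps_nth Q j * x ^ j)"
      by (auto simp: power_add mult_ac dest: sums_unique2)
    then show ?case
      using x elim pp by (simp add: x_def field_simps)
  qed
  ultimately show "(\<lambda>z. w z - principal_part a z0 z) \<midarrow>z0\<rightarrow> fps_nth Q n"
    by (rule Lim_transform_eventually)
qed

section \<open>The quotient of two analytic functions\<close>

theorem theorem2p1:
  fixes f g :: "complex \<Rightarrow> complex" and z0 :: complex and n :: nat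
  assumes "n \<ge> 1"
    and "f analytic_on {z0}" and "f z0 \<noteq> 0"
    and "g analytic_on {z0}" and "g z0 = 0"
    and "\<exists>\<^sub>F z in at z0. g z \<noteq> 0" and "zorder g z0 = int n"
  shows "has_reg_limit (\<lambda>z. f z / g z) z0
    ((deriv ^^ n) f z0 / (deriv ^^ n) g z0 +
     1 / (deriv ^^ n) g z0 *
       (\<Sum>k=1..n. fact k * of_nat (n choose k) * (deriv ^^ (n - k)) f z0 *
         (\<Sum>m\<in>partitions k. fact (num_parts k m) *
           (\<Prod>r=1..k. 1 / fact (m r) *
             (- (fact n / fact (r + n)) * ((deriv ^^ (r + n)) g z0 / (deriv ^^ n) g z0)) ^ m r))))"
proof -
  define F where "F = fps_expansion f z0"
  define G where "G = fps_expansion g z0"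
  \<comment> \<open>H expands g divided by the n-th power of x = z - z0, so its constant term is
    nonzero and Q expands the quotient f / g times that power.\<close>
  define H where "H = fps_shift n G"
  define Q where "Q = F * inverse H"
  have F: "(\<lambda>x. f (z0 + x)) has_fps_expansion F" and G: "(\<lambda>x. g (z0 + x)) has_fps_expansion G"
    unfolding F_def G_def using assms by (auto intro: analytic_at_imp_has_fps_expansion)
  have "G \<noteq> 0"
  proof
    assume "G = 0"
    then have "\<forall>\<^sub>F x in nhds 0. g (z0 + x) = 0"
      using G by (simp add: has_fps_expansion_0_iff)
    then have "\<forall>\<^sub>F x in at 0. g (z0 + x) = 0"
      by (simp add: eventually_nhds_conv_at)
    then have "\<forall>\<^sub>F z in at z0. g z = 0"
      by (subst eventually_at_to_0) (simp add: add_ac)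
    with assms(6) show False
      by (simp add: frequently_def)
  qed
  then have sub: "subdegree G = n"
    using has_fps_expansion_zorder[OF G] assms(7) by simp
  have H0: "fps_nth H 0 \<noteq> 0"
    using \<open>G \<noteq> 0\<close> sub nth_subdegree_nonzero[of G] by (simp add: H_def)
  \<comment> \<open>At x = 0 the quotient would be a division by zero, so the value there is set to
    its limit, the leading coefficient of G. Only x \<noteq> 0 matters afterwards.\<close>
  have "(\<lambda>x. if x = 0 then fps_nth G n else g (z0 + x) / x ^ n) has_fps_expansion H"
    unfolding H_def using G by (rule has_fps_expansion_shift) (simp_all add: sub)
  from has_fps_expansion_mult[OF F has_fps_expansion_inverse[OF this H0]]
  have Q: "(\<lambda>x. f (z0 + x) * inverse (if x = 0 then fps_nth G n else g (z0 + x) / x ^ n))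
      has_fps_expansion Q"
    by (simp add: Q_def)
  then have "\<forall>\<^sub>F x in at 0. eval_fps Q x =
      f (z0 + x) * inverse (if x = 0 then fps_nth G n else g (z0 + x) / x ^ n)"
    by (simp add: has_fps_expansion_def eventually_nhds_conv_at)
  moreover have "\<forall>\<^sub>F x in at (0 :: complex). x \<noteq> 0"
    by (rule eventually_neq_at_within)
  ultimately have "\<forall>\<^sub>F x in at 0. f (x + z0) / g (x + z0) = eval_fps Q x / x ^ n"
    by eventually_elim (simp add: field_simps)
  then have "\<forall>\<^sub>F z in at z0. f z / g z = eval_fps Q (z - z0) / (z - z0) ^ n"
    by (subst eventually_at_to_0) simp
  moreover have "isolated_singularity_at (\<lambda>z. f z / g z) z0"
    using assms by (intro isolated_singularity_at_divide isolated_singularity_at_analytic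
      not_essential_analytic)
  ultimately have "has_reg_limit (\<lambda>z. f z / g z) z0 (fps_nth Q n)"
    using Q by (intro has_reg_limit_pole) (auto simp: has_fps_expansion_def)
  moreover define f' where "f' = (\<lambda>k. (deriv ^^ k) f z0)"
  moreover define g' where "g' = (\<lambda>k. (deriv ^^ k) g z0)"
  moreover have "fps_nth Q n = f' n / g' n + 1 / g' n *
      (\<Sum>k=1..n. fact k * of_nat (n choose k) * f' (n - k) *
         (\<Sum>m\<in>partitions k. fact (num_parts k m) * (\<Prod>r=1..k. 1 / fact (m r) *
             (- (fact n / fact (r + n)) * (g' (r + n) / g' n)) ^ m r)))"
  proof -
    define c where "c = (\<lambda>r. - (fact n / fact (r + n)) * (g' (r + n) / g' n))"
    have F_nth: "fps_nth F k = f' k / fact k" and H_nth: "fps_nth H k = g' (k + n) / fact (k + n)" for k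
      by (simp_all add: F_def G_def H_def f'_def g'_def fps_expansion_def)
    have g'n: "g' n \<noteq> 0"
      using H0 by (simp add: H_nth)
    \<comment> \<open>The Taylor denominators (r + n)! and n! of the two coefficients of H produce
      the ratio \<open>fact n / fact (r + n)\<close> in the bracket.\<close>
    have "c = (\<lambda>r. - (fps_nth H r / fps_nth H 0))"
      by (simp add: c_def H_nth fun_eq_iff)
    then have inv: "fps_nth (inverse H) k = partition_sum c k * fact n / g' n" for k
      using fps_inverse_eq_partition_sum[OF H0, of k] by (simp add: H_nth)
    have "fps_nth Q n = (\<Sum>k=0..n. fps_nth (inverse H) k * fps_nth F (n - k))"
      by (simp add: Q_def mult.commute[of F] fps_mult_nth)
    also have "\<dots> = (\<Sum>k=0..n. 1 / g' n *
        (fact k * of_nat (n choose k) * f' (n - k) * partition_sum c k))"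
    proof (intro sum.cong refl)
      fix k assume "k \<in> {0..n}"
      \<comment> \<open>The n! from \<open>inv\<close> and the Taylor denominator (n - k)! of f
        combine to k! times the binomial coefficient.\<close>
      then have "of_nat (n choose k) = (fact n / (fact k * fact (n - k)) :: complex)"
        by (intro binomial_fact) simp
      then show "fps_nth (inverse H) k * fps_nth F (n - k) =
          1 / g' n * (fact k * of_nat (n choose k) * f' (n - k) * partition_sum c k)"
        by (simp add: inv F_nth)
    qed
    \<comment> \<open>The term k = 0 is the separate first summand, since
      \<open>partition_sum c 0 = 1\<close>.\<close>
    also have "\<dots> = f' n / g' n + (\<Sum>k=1..n. 1 / g' n *
        (fact k * of_nat (n choose k) * f' (n - k) * partition_sum c k))"
      by (subst sum.atLeast_Suc_atMost) auto
    finally show ?thesis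
      by (simp only: sum_distrib_left partition_sum_def partition_weight_def c_def)
  qed
  ultimately show ?thesis
    by simp
qed

end
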